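(* Let $a<b$ and $c<d$ be real numbers, let $\Delta=[a,b]\times[c,d]$, and let $F,G:\Delta\to\mathbb{R}_{\mathcal{I}}^{+}$ be two interval-valued co-ordinated convex functions, with $F(x,y)=[\underline{F}(x,y),\overline{F}(x,y)]$ and $G(x,y)=[\underline{G}(x,y),\overline{G}(x,y)]$. Then \begin{align*} 4F\left(\frac{a+b}{2},\frac{c+d}{2}\right)G\left(\frac{a+b}{2},\frac{c+d}{2}\right) &\supseteq \frac{1}{(b-a)(d-c)}\int_a^b\int_c^d F(x,y)G(x,y)\,dy\,dx\\ &\quad+\frac{5}{36}P(a,b,c,d)+\frac{7}{36}M(a,b,c,d)+\frac{2}{9}N(a,b,c,d), \end{align*} where \begin{align*} P(a,b,c,d)&=F(a,c)G(a,c)+F(a,d)G(a,d)+F(b,c)G(b,c)+F(b,d)G(b,d),\\ M(a,b,c,d)&=F(a,c)G(a,d)+F(a,d)G(a,c)+F(b,c)G(b,d)+F(b,d)G(b,c)\\ &\quad+F(b,c)G(a,c)+F(a,c)G(b,c)+F(b,d)G(a,d)+F(a,d)G(b,d),\\ N(a,b,c,d)&=F(b,c)G(a,d)+F(a,d)G(b,c)+F(b,d)G(a,c)+F(a,c)G(b,d). \end{align*}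
   Context: $\mathbb{R}_{\mathcal{I}}^{+}$ denotes the family of all positive closed bounded intervals $X=[\underline{X},\overline{X}]$ of $\mathbb{R}$, i.e. $0<\underline{X}\le\overline{X}$ (degenerate intervals $\underline{X}=\overline{X}$ are allowed). Interval operations: $X+Y=[\underline{X}+\underline{Y},\overline{X}+\overline{Y}]$; for $\lambda\ge 0$, $\lambda X=[\lambda\underline{X},\lambda\overline{X}]$; and for positive intervals $XY=[\underline{X}\,\underline{Y},\overline{X}\,\overline{Y}]$. The relation $\supseteq$ is set inclusion: $X\supseteq Y$ iff $\underline{X}\le\underline{Y}$ and $\overline{Y}\le\overline{X}$. A function $F:\Delta=[a,b]\times[c,d]\to\mathbb{R}_{\mathcal{I}}^{+}$ is interval-valued co-ordinated convex if for all $x,y\in[a,b]$, all $u,w\in[c,d]$ and all $s,t\in[0,1]$, $$F(tx+(1-t)y,\,su+(1-s)w)\supseteq tsF(x,u)+t(1-s)F(x,w)+s(1-t)F(y,u)+(1-s)(1-t)F(y,w).$$ Integrals are interval-valued Riemann integrals: an interval-valued function $H=[\underline{H},\overline{H}]$ on $[p,q]$ is integrable iff $\underline{H}$ and $\overline{H}$ are Riemann integrable, and then $\int_p^q H(t)\,dt=\left[\int_p^q\underline{H}(t)\,dt,\int_p^q\overline{H}(t)\,dt\right]$. The double integral over $\Delta$ is the interval-valued double Riemann integral, which equals the iterated integral. *)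

theory Defs
  imports "HOL-Analysis.Analysis" "HOL-Library.Interval"
begin

text \<open>
  Closed bounded intervals are elements of the library type \<^typ>\<open>real interval\<close>; degenerate
  intervals are included.  The library product is the set-theoretic one, which for positive
  intervals is the endpointwise product (see the lemmas below).
\<close>

definition pos_interval :: "real interval \<Rightarrow> bool" where
  "pos_interval X \<longleftrightarrow> 0 < lower X"

text \<open>Scalar multiples are only used for nonnegative scalars.\<close>

abbreviation scale_interval :: "real \<Rightarrow> real interval \<Rightarrow> real interval" (infixr "*\<^sub>I" 75) where
  "r *\<^sub>I X \<equiv> interval_of r * X"

lemma scale_interval_bounds:
  assumes "0 \<le> r"
  shows "lower (r *\<^sub>I X) = r * lower X" and "upper (r *\<^sub>I X) = r * upper X"
  using mult_left_mono[OF lower_le_upper[of X] assms]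
  by (simp_all add: lower_times upper_times)

lemma pos_interval_times_bounds:
  assumes "pos_interval X" and "pos_interval Y"
  shows "lower (X * Y) = lower X * lower Y" and "upper (X * Y) = upper X * upper Y"
proof -
  have X: "0 < lower X" "lower X \<le> upper X" and Y: "0 < lower Y" "lower Y \<le> upper Y"
    using assms by (auto simp: pos_interval_def)
  then have "0 \<le> upper X" "0 \<le> upper Y" by linarith+
  have 1: "lower X * lower Y \<le> lower X * upper Y" "lower X * lower Y \<le> upper X * lower Y"
    "lower X * upper Y \<le> upper X * upper Y" "upper X * lower Y \<le> upper X * upper Y"
    using X Y \<open>0 \<le> upper X\<close> \<open>0 \<le> upper Y\<close> by (auto intro!: mult_left_mono mult_right_mono)
  then show "lower (X * Y) = lower X * lower Y" "upper (X * Y) = upper X * upper Y"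
    by (auto simp: lower_times upper_times min_def max_def)
qed

definition ivl_coord_convex_on ::
  "real \<Rightarrow> real \<Rightarrow> real \<Rightarrow> real \<Rightarrow> (real \<Rightarrow> real \<Rightarrow> real interval) \<Rightarrow> bool" where
  "ivl_coord_convex_on a b c d F \<longleftrightarrow>
    (\<forall>x\<in>{a..b}. \<forall>y\<in>{a..b}. \<forall>u\<in>{c..d}. \<forall>w\<in>{c..d}. \<forall>s\<in>{0..1}. \<forall>t\<in>{0..1}.
      set_of (F (t * x + (1 - t) * y) (s * u + (1 - s) * w)) \<supseteq>
      set_of ((t * s) *\<^sub>I F x u + (t * (1 - s)) *\<^sub>I F x w
            + (s * (1 - t)) *\<^sub>I F y u + ((1 - s) * (1 - t)) *\<^sub>I F y w))"

text \<open>
  The Riemann integral over a box: in contrast to the gauge integral of the library, the fineness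
  of the tagged divisions is bounded uniformly.
\<close>

definition has_riemann_integral ::
  "('n::euclidean_space \<Rightarrow> real) \<Rightarrow> real \<Rightarrow> 'n set \<Rightarrow> bool" (infixr "has'_riemann'_integral" 46)
  where
  "(f has_riemann_integral I) S \<longleftrightarrow>
    (\<forall>e>0. \<exists>\<delta>>0. \<forall>p. p tagged_division_of S \<and> (\<forall>(x, K)\<in>p. diameter K < \<delta>) \<longrightarrow>
      \<bar>(\<Sum>(x, K)\<in>p. measure lborel K * f x) - I\<bar> < e)"

definition riemann_integrable_on ::
  "('n::euclidean_space \<Rightarrow> real) \<Rightarrow> 'n set \<Rightarrow> bool" (infixr "riemann'_integrable'_on" 46) where
  "f riemann_integrable_on S \<longleftrightarrow> (\<exists>I. (f has_riemann_integral I) S)"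

definition riemann_integral :: "'n::euclidean_space set \<Rightarrow> ('n \<Rightarrow> real) \<Rightarrow> real" where
  "riemann_integral S f = (THE I. (f has_riemann_integral I) S)"

definition ivl_riemann_integrable_on ::
  "('n::euclidean_space \<Rightarrow> real interval) \<Rightarrow> 'n set \<Rightarrow> bool"
  (infixr "ivl'_riemann'_integrable'_on" 46) where
  "H ivl_riemann_integrable_on S \<longleftrightarrow>
    (\<lambda>z. lower (H z)) riemann_integrable_on S \<and> (\<lambda>z. upper (H z)) riemann_integrable_on S"

definition ivl_riemann_integral ::
  "'n::euclidean_space set \<Rightarrow> ('n \<Rightarrow> real interval) \<Rightarrow> real interval" where
  "ivl_riemann_integral S H =
    Ivl (riemann_integral S (\<lambda>z. lower (H z))) (riemann_integral S (\<lambda>z. upper (H z)))"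

definition vertex_sum_P ::
  "(real \<Rightarrow> real \<Rightarrow> real interval) \<Rightarrow> (real \<Rightarrow> real \<Rightarrow> real interval) \<Rightarrow>
   real \<Rightarrow> real \<Rightarrow> real \<Rightarrow> real \<Rightarrow> real interval" where
  "vertex_sum_P F G a b c d =
    F a c * G a c + F a d * G a d + F b c * G b c + F b d * G b d"

definition vertex_sum_M ::
  "(real \<Rightarrow> real \<Rightarrow> real interval) \<Rightarrow> (real \<Rightarrow> real \<Rightarrow> real interval) \<Rightarrow>
   real \<Rightarrow> real \<Rightarrow> real \<Rightarrow> real \<Rightarrow> real interval" where
  "vertex_sum_M F G a b c d =
    F a c * G a d + F a d * G a c + F b c * G b d + F b d * G b c
    + F b c * G a c + F a c * G b c + F b d * G a d + F a d * G b d"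

definition vertex_sum_N ::
  "(real \<Rightarrow> real \<Rightarrow> real interval) \<Rightarrow> (real \<Rightarrow> real \<Rightarrow> real interval) \<Rightarrow>
   real \<Rightarrow> real \<Rightarrow> real \<Rightarrow> real \<Rightarrow> real interval" where
  "vertex_sum_N F G a b c d =
    F b c * G a d + F a d * G b c + F b d * G a c + F a c * G b d"

end

theory Submission
  imports Defs
begin

text \<open>
  The inclusion of intervals says two things about real functions: the products of the lower
  endpoints satisfy the inequality in one direction, the products of the upper endpoints in the
  other.  Lower endpoints of a co-ordinated convex interval function form a co-ordinated convex
  real function, upper endpoints a co-ordinated concave one, so the two parts are mirror images.

  Let \<open>f\<close> and \<open>g\<close> be the nonnegative co-ordinated convex functions of the lower part, \<open>m\<close> the centre
  of the rectangle, and let \<open>p\<close> range over the four images of a point under the reflections of the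
  rectangle in its axes.  Convexity gives \<open>4 f(m) \<le> \<Sum>\<^sub>p f(p)\<close>, and the same for \<open>g\<close>.  Multiplying,
  \<open>16 f(m) g(m)\<close> is at most \<open>\<Sum>\<^sub>p f(p) g(p)\<close> plus the twelve mixed products \<open>f(p) g(q)\<close>, \<open>p \<noteq> q\<close>.  On a
  rectangle \<open>f\<close> lies below its bilinear interpolant \<open>Bf\<close> at the corners, so in the mixed products
  \<open>f\<close> and \<open>g\<close> may be replaced by \<open>Bf\<close> and \<open>Bg\<close>.  Now \<open>\<Sum>\<^sub>p Bf(p)\<close> is constant, equal to the sum \<open>Sf\<close> of
  the corner values; hence the mixed products of the interpolants are \<open>Sf Sg - \<Sum>\<^sub>p Bf(p) Bg(p)\<close>, and
  \<open>16 f(m) g(m) \<le> Sf Sg + \<Sum>\<^sub>p (f(p) g(p) - Bf(p) Bg(p))\<close>.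

  Averaging over the rectangle, the reflections drop out and \<open>4 f(m) g(m)\<close> is bounded by the mean of
  \<open>f g\<close> plus \<open>Sf Sg / 4\<close> minus the mean of \<open>Bf Bg\<close>.  The product \<open>Sf Sg\<close> is \<open>P + M + N\<close> and the mean of
  \<open>Bf Bg\<close> is \<open>P/9 + M/18 + N/36\<close>, which produces the coefficients \<open>5/36\<close>, \<open>7/36\<close> and \<open>2/9\<close>.  The upper
  part reverses every inequality; nonnegativity is what permits the multiplications.  See
  \<open>sum_product_minus_diagonal_mono\<close>, \<open>has_integral_symmetrized_comparison\<close>,
  \<open>coord_convex_product_midpoint_le\<close> and \<open>coord_concave_product_midpoint_ge\<close>.

  Integrability of \<open>f g\<close> in the sense of Riemann is a consequence of convexity as well.  A
  co-ordinated convex function is bounded on the closed rectangle and continuous in the open one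
  (\<open>coord_convex_on_bounded\<close>, \<open>coord_convex_on_continuous\<close>), although it may jump on the boundary,
  and such functions are Riemann integrable
  (\<open>has_riemann_integral_if_bounded_continuous_on_box\<close>).
\<close>

section \<open>Riemann integrals over boxes\<close>

text \<open>
  A uniform mesh bound is a gauge consisting of balls of constant radius, so the whole theory of
  the gauge integral, in particular uniqueness and monotonicity, applies to Riemann integrals.
\<close>

lemma has_riemann_integral_imp_has_integral:
  fixes f :: "'n::euclidean_space \<Rightarrow> real"
  assumes "(f has_riemann_integral I) (cbox u v)"
  shows "(f has_integral I) (cbox u v)"
  unfolding has_integral
proof (intro allI impI)
  fix e :: real assume "e > 0"
  then obtain \<delta> where "\<delta> > 0" and \<delta>:
    "\<And>p. p tagged_division_of cbox u v \<Longrightarrow> \<forall>(x, K)\<in>p. diameter K < \<delta> \<Longrightarrow>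
      \<bar>(\<Sum>(x, K)\<in>p. measure lborel K * f x) - I\<bar> < e"
    using assms unfolding has_riemann_integral_def by meson
  have small: "diameter K < \<delta>" if "K \<subseteq> ball x (\<delta> / 3)" for x :: 'n and K
  proof -
    have "diameter K \<le> diameter (ball x (\<delta> / 3))"
      using that by (intro diameter_subset) auto
    also have "\<dots> < \<delta>" using \<open>\<delta> > 0\<close> by (simp add: diameter_ball)
    finally show ?thesis .
  qed
  show "\<exists>\<gamma>. gauge \<gamma> \<and> (\<forall>p. p tagged_division_of cbox u v \<and> \<gamma> fine p \<longrightarrow>
      norm ((\<Sum>(x, K)\<in>p. measure lborel K *\<^sub>R f x) - I) < e)"
  proof (intro exI[of _ "\<lambda>x. ball x (\<delta> / 3)"] conjI allI impI)
    show "gauge (\<lambda>x::'n. ball x (\<delta> / 3))" using \<open>\<delta> > 0\<close> by (intro gauge_ball) simp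
    fix p assume p: "p tagged_division_of cbox u v \<and> (\<lambda>x. ball x (\<delta> / 3)) fine p"
    then have "\<forall>(x, K)\<in>p. diameter K < \<delta>" by (metis (no_types, lifting) case_prodI2 fineD small)
    from \<delta>[OF _ this] p show "norm ((\<Sum>(x, K)\<in>p. measure lborel K *\<^sub>R f x) - I) < e"
      by simp
  qed
qed

lemma riemann_integral_unique:
  fixes f :: "'n::euclidean_space \<Rightarrow> real"
  assumes "(f has_riemann_integral I) (cbox u v)"
  shows "riemann_integral (cbox u v) f = I"
  unfolding riemann_integral_def
  using assms has_integral_unique has_riemann_integral_imp_has_integral by blast

lemma has_riemann_integral_cong:
  assumes "\<And>x. x \<in> S \<Longrightarrow> f x = g x"
  shows "(f has_riemann_integral I) S \<longleftrightarrow> (g has_riemann_integral I) S"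
proof -
  have "(\<Sum>(x, K)\<in>p. measure lborel K * f x) = (\<Sum>(x, K)\<in>p. measure lborel K * g x)"
    if "p tagged_division_of S" for p
    using assms tagged_division_ofD(2,3)[OF that] by (intro sum.cong) (auto, blast)
  then show ?thesis unfolding has_riemann_integral_def by auto
qed

lemma integrable_on_cbox_if_bounded_continuous_on_box:
  fixes f :: "'n::euclidean_space \<Rightarrow> real"
  assumes bound: "\<And>x. x \<in> cbox u v \<Longrightarrow> \<bar>f x\<bar> \<le> B"
    and cont: "continuous_on (box u v) f"
  shows "f integrable_on cbox u v"
proof -
  have "f integrable_on box u v"
  proof (rule measurable_bounded_by_integrable_imp_integrable)
    show "f \<in> borel_measurable (lebesgue_on (box u v))"
      using cont by (intro continuous_imp_measurable_on_sets_lebesgue) auto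
    show "(\<lambda>_. B) integrable_on box u v"
      unfolding integrable_on_open_interval by (rule integrable_const)
    show "\<And>x. x \<in> box u v \<Longrightarrow> norm (f x) \<le> B"
      using bound box_subset_cbox by fastforce
  qed auto
  then show ?thesis
    by (simp add: integrable_on_open_interval)
qed

text \<open>
  Discontinuities on the boundary are harmless because the boundary can be covered with little
  volume.  Choose a compact subset \<open>C\<close> of the open box that misses only a small volume \<open>\<eta>\<close>.  In a fine
  tagged division, the cells that meet \<open>C\<close> stay in a compact neighbourhood \<open>C'\<close> of \<open>C\<close>, where \<open>f\<close> is
  uniformly continuous, and contribute a small error.  The remaining cells have total volume at
  most \<open>\<eta>\<close>, and boundedness of \<open>f\<close> controls their error.
\<close>

lemma has_riemann_integral_if_bounded_continuous_on_box:
  fixes f :: "'n::euclidean_space \<Rightarrow> real"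
  assumes bound: "\<And>x. x \<in> cbox u v \<Longrightarrow> \<bar>f x\<bar> \<le> B"
    and cont: "continuous_on (box u v) f"
  shows "(f has_riemann_integral integral (cbox u v) f) (cbox u v)"
  unfolding has_riemann_integral_def
proof (intro allI impI)
  fix e :: real assume "e > 0"
  \<comment> \<open>\<open>B\<close> can be zero, or negative if the box is empty, but the choice of \<open>\<eta>\<close> divides by the bound.\<close>
  define B' where "B' = \<bar>B\<bar> + 1"
  have "B' > 0" unfolding B'_def by linarith
  have bound': "\<bar>f x\<bar> \<le> B'" if "x \<in> cbox u v" for x
    using bound[OF that] unfolding B'_def by linarith
  have integrable: "f integrable_on cbox u v"
    using bound cont by (rule integrable_on_cbox_if_bounded_continuous_on_box)
  define \<eta> where "\<eta> = e / (8 * B')"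
  have "\<eta> > 0" using \<open>e > 0\<close> \<open>B' > 0\<close> by (simp add: \<eta>_def)
  define \<epsilon> where "\<epsilon> = e / (4 * (measure lborel (cbox u v) + 1))"
  have c1: "measure lborel (cbox u v) + 1 > 0"
    using measure_nonneg[of lborel "cbox u v"] by linarith
  then have "\<epsilon> > 0" using \<open>e > 0\<close> by (simp add: \<epsilon>_def)
  obtain C where "closed C" "C \<subseteq> box u v" "box u v - C \<in> lmeasurable"
      and small: "emeasure lebesgue (box u v - C) < ennreal \<eta>"
    using sets_lebesgue_inner_closed[of "box u v" \<eta>] \<open>\<eta> > 0\<close> by auto
  have "compact C"
    using \<open>closed C\<close> \<open>C \<subseteq> box u v\<close> bounded_box bounded_subset compact_eq_bounded_closed by blast
  have measure_C: "measure lborel (cbox u v) - \<eta> \<le> measure lebesgue C"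
  proof -
    have "C \<in> lmeasurable" using \<open>compact C\<close> by (rule lmeasurable_compact)
    have "measure lebesgue (box u v) = measure lebesgue (box u v - C) + measure lebesgue C"
      using \<open>C \<in> lmeasurable\<close> \<open>C \<subseteq> box u v\<close>
      by (subst measurable_measure_Diff) auto
    moreover have "measure lebesgue (box u v - C) < \<eta>"
      using small \<open>\<eta> > 0\<close> \<open>box u v - C \<in> lmeasurable\<close>
      by (simp add: emeasure_eq_measure2 ennreal_less_iff)
    moreover have "measure lebesgue (box u v) = measure lborel (cbox u v)"
      by (simp add: measure_lborel_box_eq measure_lborel_cbox_eq)
    ultimately show ?thesis by linarith
  qed
  obtain r where "r > 0" and r: "(\<Union>x\<in>C. cball x r) \<subseteq> box u v"
    using compact_subset_open_imp_cball_epsilon_subset[OF \<open>compact C\<close> open_box \<open>C \<subseteq> box u v\<close>] .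
  define C' where "C' = (\<Union>x\<in>C. cball x r)"
  have "compact C'" unfolding C'_def using \<open>compact C\<close> by (rule compact_minkowski_sum_cball)
  have "uniformly_continuous_on C' f"
    using \<open>compact C'\<close> r cont
    by (intro compact_uniformly_continuous) (auto simp: C'_def intro: continuous_on_subset)
  then obtain \<delta>\<^sub>0 where "\<delta>\<^sub>0 > 0" and \<delta>\<^sub>0:
    "\<And>x y. x \<in> C' \<Longrightarrow> y \<in> C' \<Longrightarrow> dist y x < \<delta>\<^sub>0 \<Longrightarrow> dist (f y) (f x) < \<epsilon>"
    using \<open>\<epsilon> > 0\<close> unfolding uniformly_continuous_on_def by metis
  show "\<exists>\<delta>>0. \<forall>p. p tagged_division_of cbox u v \<and> (\<forall>(x, K)\<in>p. diameter K < \<delta>) \<longrightarrow>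
      \<bar>(\<Sum>(x, K)\<in>p. measure lborel K * f x) - integral (cbox u v) f\<bar> < e"
  proof (intro exI[of _ "min \<delta>\<^sub>0 r"] conjI allI impI)
    show "min \<delta>\<^sub>0 r > 0" using \<open>\<delta>\<^sub>0 > 0\<close> \<open>r > 0\<close> by simp
    fix p assume *: "p tagged_division_of cbox u v \<and> (\<forall>(x, K)\<in>p. diameter K < min \<delta>\<^sub>0 r)"
    then have p: "p tagged_division_of cbox u v" by blast
    then have "finite p" by blast
    define good where "good = {(x, K) \<in> p. K \<inter> C \<noteq> {}}"
    define bad where "bad = p - good"
    have fin: "finite good" "finite bad" and sub: "good \<subseteq> p" "bad \<subseteq> p"
      using \<open>finite p\<close> by (auto simp: good_def bad_def intro: finite_subset)
    have split: "sum h p = sum h good + sum h bad" for h :: "'n \<times> 'n set \<Rightarrow> real"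
      unfolding bad_def using \<open>finite p\<close> sub by (simp add: sum.subset_diff)
    have dist: "dist y z < min \<delta>\<^sub>0 r" if "(x, K) \<in> p" "y \<in> K" "z \<in> K" for x K y z
    proof -
      have "bounded K" using tagged_division_ofD(4)[OF p that(1)] by auto
      then have "dist y z \<le> diameter K" using that diameter_bounded_bound by blast
      then show ?thesis using * that(1) by fastforce
    qed
    have content_bad: "(\<Sum>(x, K)\<in>bad. measure lborel K) \<le> \<eta>"
    proof -
      have K: "K \<in> lmeasurable" if "(x, K) \<in> p" for x K
        using tagged_division_ofD(4)[OF p that] by auto
      have "C \<subseteq> (\<Union>z\<in>good. snd z)"
      proof
        fix y assume "y \<in> C"
        then have "y \<in> \<Union>{K. \<exists>x. (x, K) \<in> p}"
          using tagged_division_ofD(6)[OF p] \<open>C \<subseteq> box u v\<close> box_subset_cbox[of u v] by blast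
        then obtain x K where "(x, K) \<in> p" "y \<in> K" by blast
        with \<open>y \<in> C\<close> have "(x, K) \<in> good" by (auto simp: good_def)
        with \<open>y \<in> K\<close> show "y \<in> (\<Union>z\<in>good. snd z)" by force
      qed
      then have "measure lebesgue C \<le> measure lebesgue (\<Union>z\<in>good. snd z)"
        using \<open>compact C\<close> fin K sub
        by (intro measure_mono_fmeasurable) (auto simp: lmeasurable_compact fmeasurableD intro!: fmeasurable.finite_UN)
      also have "\<dots> \<le> (\<Sum>z\<in>good. measure lebesgue (snd z))"
        using fin K sub by (intro measure_UNION_le) (auto intro!: fmeasurableD)
      also have "\<dots> = (\<Sum>(x, K)\<in>good. measure lborel K)"
      proof (rule sum.cong[OF refl], clarify)
        fix x K assume "(x, K) \<in> good"
        then obtain w z where "K = cbox w z" using sub tagged_division_ofD(4)[OF p] by blast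
        then show "measure lebesgue (snd (x, K)) = measure lborel K" by simp
      qed
      finally show ?thesis
        using measure_C split[of "\<lambda>(x, K). measure lborel K"] additive_content_tagged_division[OF p]
        by linarith
    qed
    define err where "err = (\<lambda>(x, K). measure lborel K * f x - integral K f)"
    have has_int: "((\<lambda>y. f x - f y) has_integral err (x, K)) K" if "(x, K) \<in> p" for x K
    proof -
      obtain w z where K: "K = cbox w z" using tagged_division_ofD(4)[OF p \<open>(x, K) \<in> p\<close>] by blast
      have "(f has_integral integral K f) K"
        using integrable tagged_division_ofD(3)[OF p that] K
        by (metis integrable_integral integrable_on_subcbox)
      from has_integral_diff[OF has_integral_const[of "f x" w z] this[unfolded K]] show ?thesis
        by (simp add: err_def K)
    qed
    have err_bound: "\<bar>err (x, K)\<bar> \<le> D * measure lborel K"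
      if "(x, K) \<in> p" "0 \<le> D" "\<And>y. y \<in> K \<Longrightarrow> \<bar>f x - f y\<bar> \<le> D" for x K D
    proof -
      obtain w z where K: "K = cbox w z" using tagged_division_ofD(4)[OF p \<open>(x, K) \<in> p\<close>] by blast
      show ?thesis
        using has_integral_bound[OF \<open>0 \<le> D\<close>, of "\<lambda>y. f x - f y" "err (x, K)" w z] has_int[OF that(1)] that(3)
        by (simp add: K)
    qed
    have err_good: "\<bar>err z\<bar> \<le> (case z of (x, K) \<Rightarrow> \<epsilon> * measure lborel K)" if "z \<in> good" for z
    proof -
      obtain x K where z: "z = (x, K)" by (cases z)
      then have xK: "(x, K) \<in> p" "K \<inter> C \<noteq> {}" using that by (auto simp: good_def)
      then obtain k where k: "k \<in> K" "k \<in> C" by blast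
      have "K \<subseteq> C'" 
      proof
        fix y assume "y \<in> K"
        then have "dist k y \<le> r" using dist[OF xK(1) k(1)] by fastforce
        then show "y \<in> C'" using k(2) by (auto simp: C'_def)
      qed
      then have "\<bar>f x - f y\<bar> \<le> \<epsilon>" if "y \<in> K" for y
        using \<delta>\<^sub>0[of y x] dist[OF xK(1) _ that, of x] tagged_division_ofD(2)[OF p xK(1)] that
        by (fastforce simp: dist_real_def)
      then show ?thesis using err_bound[OF xK(1)] \<open>\<epsilon> > 0\<close> z by simp
    qed
    have err_bad: "\<bar>err z\<bar> \<le> (case z of (x, K) \<Rightarrow> 2 * B' * measure lborel K)" if "z \<in> bad" for z
    proof -
      obtain x K where z: "z = (x, K)" by (cases z)
      then have xK: "(x, K) \<in> p" using that sub by auto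
      have "\<bar>f x - f y\<bar> \<le> 2 * B'" if "y \<in> K" for y
        using bound'[of x] bound'[of y] that tagged_division_ofD(2,3)[OF p xK] by fastforce
      then show ?thesis using err_bound[OF xK] \<open>B' > 0\<close> z by simp
    qed
    have "(\<Sum>(x, K)\<in>p. measure lborel K * f x) - integral (cbox u v) f = sum err p"
      unfolding integral_combine_tagged_division_topdown[OF integrable p] err_def
      by (simp add: sum_subtractf case_prod_unfold)
    also have "\<bar>\<dots>\<bar> \<le> (\<Sum>z\<in>p. \<bar>err z\<bar>)" by (rule sum_abs)
    also have "\<dots> = (\<Sum>z\<in>good. \<bar>err z\<bar>) + (\<Sum>z\<in>bad. \<bar>err z\<bar>)" by (rule split)
    also have "\<dots> \<le> (\<Sum>(x, K)\<in>good. \<epsilon> * measure lborel K) + (\<Sum>(x, K)\<in>bad. 2 * B' * measure lborel K)"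
      using err_good err_bad by (intro add_mono sum_mono)
    also have "\<dots> = \<epsilon> * (\<Sum>(x, K)\<in>good. measure lborel K) + 2 * B' * (\<Sum>(x, K)\<in>bad. measure lborel K)"
      by (simp add: sum_distrib_left case_prod_unfold)
    also have "\<dots> \<le> \<epsilon> * measure lborel (cbox u v) + 2 * B' * \<eta>"
    proof (intro add_mono mult_left_mono content_bad)
      have "0 \<le> (\<Sum>(x, K)\<in>bad. measure lborel K)" by (intro sum_nonneg) auto
      then show "(\<Sum>(x, K)\<in>good. measure lborel K) \<le> measure lborel (cbox u v)"
        using split[of "\<lambda>(x, K). measure lborel K"] additive_content_tagged_division[OF p] by linarith
    qed (use \<open>\<epsilon> > 0\<close> \<open>B' > 0\<close> in auto)
    also have "\<dots> \<le> e / 4 + e / 4"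
    proof (rule add_mono)
      have "\<epsilon> * measure lborel (cbox u v) \<le> \<epsilon> * (measure lborel (cbox u v) + 1)"
        using \<open>\<epsilon> > 0\<close> by (intro mult_left_mono) auto
      also have "\<dots> = e / 4"
      proof -
        have "e / (4 * X) * X = e / 4" if "X > 0" for X :: real using that by simp
        from this[OF c1] show ?thesis unfolding \<epsilon>_def .
      qed
      finally show "\<epsilon> * measure lborel (cbox u v) \<le> e / 4" .
      show "2 * B' * \<eta> \<le> e / 4" using \<open>B' > 0\<close> by (simp add: \<eta>_def)
    qed
    also have "\<dots> < e" using \<open>e > 0\<close> by simp
    finally show "\<bar>(\<Sum>(x, K)\<in>p. measure lborel K * f x) - integral (cbox u v) f\<bar> < e" .
  qed
qed

section \<open>Bilinear interpolation and reflections of a rectangle\<close>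

definition linterp :: "real \<Rightarrow> real \<Rightarrow> real \<Rightarrow> real \<Rightarrow> real \<Rightarrow> real" where
  "linterp a b p q x = ((b - x) * p + (x - a) * q) / (b - a)"

text \<open>
  Interpolating in the first variable along both horizontal edges and then in the second one makes
  the one-dimensional facts about \<open>linterp\<close> applicable twice.
\<close>

definition bilinterp ::
  "real \<Rightarrow> real \<Rightarrow> real \<Rightarrow> real \<Rightarrow> (real \<Rightarrow> real \<Rightarrow> real) \<Rightarrow> real \<Rightarrow> real \<Rightarrow> real" where
  "bilinterp a b c d f x y =
    linterp c d (linterp a b (f a c) (f b c) x) (linterp a b (f a d) (f b d) x) y"

definition sum_reflections ::
  "real \<Rightarrow> real \<Rightarrow> real \<Rightarrow> real \<Rightarrow> (real \<Rightarrow> real \<Rightarrow> real) \<Rightarrow> real \<Rightarrow> real \<Rightarrow> real" where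
  "sum_reflections a b c d h x y =
    h x y + h (a + b - x) y + h x (c + d - y) + h (a + b - x) (c + d - y)"

definition corner_sum :: "real \<Rightarrow> real \<Rightarrow> real \<Rightarrow> real \<Rightarrow> (real \<Rightarrow> real \<Rightarrow> real) \<Rightarrow> real" where
  "corner_sum a b c d f = f a c + f a d + f b c + f b d"

lemma linterp_nonneg:
  "a < b \<Longrightarrow> x \<in> {a..b} \<Longrightarrow> 0 \<le> p \<Longrightarrow> 0 \<le> q \<Longrightarrow> 0 \<le> linterp a b p q x"
  by (simp add: linterp_def)

lemma linterp_reflect:
  assumes "a < b"
  shows "linterp a b p q x + linterp a b p q (a + b - x) = p + q"
proof -
  have "(b - x) * p + (x - a) * q + ((b - (a + b - x)) * p + ((a + b - x) - a) * q)
      = (b - a) * (p + q)"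
    by (simp add: algebra_simps)
  then show ?thesis using assms by (simp add: linterp_def flip: add_divide_distrib)
qed

lemma linterp_add:
  "linterp a b p q x + linterp a b p' q' x = linterp a b (p + p') (q + q') x"
  by (simp add: linterp_def distrib_left flip: add_divide_distrib)

lemma linterp_minus: "linterp a b (- p) (- q) x = - linterp a b p q x"
  unfolding linterp_def minus_divide_left by simp

lemma bilinterp_minus: "bilinterp a b c d (\<lambda>x y. - f x y) x y = - bilinterp a b c d f x y"
  by (simp add: bilinterp_def linterp_minus)

lemma bilinterp_nonneg:
  assumes "a < b" "c < d" "x \<in> {a..b}" "y \<in> {c..d}"
    and "\<And>x y. x \<in> {a..b} \<Longrightarrow> y \<in> {c..d} \<Longrightarrow> 0 \<le> f x y"
  shows "0 \<le> bilinterp a b c d f x y"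
  unfolding bilinterp_def using assms by (intro linterp_nonneg) auto

text \<open>
  The symmetrization of an interpolant is constant because the weights of an affine interpolation
  at \<open>x\<close> and \<open>a + b - x\<close> are exchanged.  This is what turns the mixed products of two interpolants
  into a constant minus the diagonal ones.
\<close>

lemma sum_reflections_bilinterp:
  assumes "a < b" "c < d"
  shows "sum_reflections a b c d (bilinterp a b c d f) x y = corner_sum a b c d f"
proof -
  have "bilinterp a b c d f x y + bilinterp a b c d f (a + b - x) y
      = linterp c d (f a c + f b c) (f a d + f b d) y" for y
    by (simp add: bilinterp_def linterp_add linterp_reflect[OF assms(1)])
  from this[of y] this[of "c + d - y"] linterp_reflect[OF assms(2), of "f a c + f b c" "f a d + f b d" y]
  show ?thesis unfolding sum_reflections_def corner_sum_def by linarith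
qed

lemma has_integral_linterp_mult_linterp:
  assumes "a < b"
  shows "((\<lambda>x. linterp a b p q x * linterp a b p' q' x) has_integral
    (b - a) * ((2 * p * p' + p * q' + q * p' + 2 * q * q') / 6)) {a..b}"
proof -
  define D where "D = b - a"
  have "D \<noteq> 0" using assms by (simp add: D_def)
  define A where "A x = p * p' * (x - a) + (p * (q' - p') + p' * (q - p)) / D * (x - a)\<^sup>2 / 2
      + (q - p) * (q' - p') / D\<^sup>2 * (x - a) ^ 3 / 3" for x
  have lin: "linterp a b p q x = p + (q - p) / D * (x - a)" for p q x
    unfolding linterp_def D_def using assms by (simp add: field_simps)
  have "((\<lambda>x. linterp a b p q x * linterp a b p' q' x) has_integral A b - A a) {a..b}"
  proof (rule fundamental_theorem_of_calculus)
    fix x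
    have "(A has_real_derivative linterp a b p q x * linterp a b p' q' x) (at x)"
      unfolding A_def lin using \<open>D \<noteq> 0\<close>
      by (auto intro!: derivative_eq_intros simp: field_simps power2_eq_square)
    then show "(A has_vector_derivative linterp a b p q x * linterp a b p' q' x) (at x within {a..b})"
      by (simp add: has_real_derivative_iff_has_vector_derivative has_vector_derivative_at_within)
  qed (use assms in simp)
  moreover have "A b - A a = D * ((2 * p * p' + p * q' + q * p' + 2 * q * q') / 6)"
    unfolding A_def D_def[symmetric] using \<open>D \<noteq> 0\<close>
    by (simp add: field_simps power2_eq_square power3_eq_cube)
  ultimately show ?thesis by (simp add: D_def)
qed

text \<open>
  The mean over the rectangle of the product of the two bilinear interpolants: the one-dimensional
  formula \<open>(2 p p' + p q' + q p' + 2 q q') / 6\<close> in each variable.  Expanded, it is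
  \<open>P / 9 + M / 18 + N / 36\<close> in terms of the products of vertex values.
\<close>

definition corner_product_mean ::
  "real \<Rightarrow> real \<Rightarrow> real \<Rightarrow> real \<Rightarrow> (real \<Rightarrow> real \<Rightarrow> real) \<Rightarrow> (real \<Rightarrow> real \<Rightarrow> real) \<Rightarrow> real" where
  "corner_product_mean a b c d f g =
    (let m = (\<lambda>y y'. (2 * f a y * g a y' + f a y * g b y' + f b y * g a y' + 2 * f b y * g b y') / 6)
     in (2 * m c c + m c d + m d c + 2 * m d d) / 6)"

lemma has_integral_bilinterp_mult_bilinterp:
  assumes "a < b" "c < d"
  shows "((\<lambda>(x, y). bilinterp a b c d f x y * bilinterp a b c d g x y) has_integral
    (b - a) * (d - c) * corner_product_mean a b c d f g) (cbox (a, c) (b, d))"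
proof -
  let ?h = "\<lambda>(x, y). bilinterp a b c d f x y * bilinterp a b c d g x y"
  define l where "l f y x = linterp a b (f a y) (f b y) x" for f :: "real \<Rightarrow> real \<Rightarrow> real" and y x
  define m where
    "m y y' = (2 * f a y * g a y' + f a y * g b y' + f b y * g a y' + 2 * f b y * g b y') / 6" for y y'
  have cont: "continuous_on (cbox (a, c) (b, d)) ?h"
    unfolding bilinterp_def linterp_def case_prod_unfold using assms by (intro continuous_intros) auto
  have inner: "integral (cbox c d) (\<lambda>y. ?h (x, y)) = (d - c) *
      ((2 * (l f c x * l g c x) + l f c x * l g d x + l f d x * l g c x + 2 * (l f d x * l g d x)) / 6)" for x
    using has_integral_linterp_mult_linterp[OF \<open>c < d\<close>, of "l f c x" "l f d x" "l g c x" "l g d x"]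
    by (simp add: bilinterp_def l_def integral_unique mult.assoc)
  have ll: "((\<lambda>x. l f y x * l g y' x) has_integral (b - a) * m y y') (cbox a b)" for y y'
    using has_integral_linterp_mult_linterp[OF \<open>a < b\<close>, of "f a y" "f b y" "g a y'" "g b y'"]
    by (simp add: l_def m_def)
  have "((\<lambda>x. (d - c) *
      ((2 * (l f c x * l g c x) + l f c x * l g d x + l f d x * l g c x + 2 * (l f d x * l g d x)) / 6))
    has_integral (d - c) * ((2 * ((b - a) * m c c) + (b - a) * m c d + (b - a) * m d c
        + 2 * ((b - a) * m d d)) / 6)) (cbox a b)"
    by (intro has_integral_mult_right has_integral_divide has_integral_add ll)
  then have "integral (cbox a b) (\<lambda>x. integral (cbox c d) (\<lambda>y. ?h (x, y)))
      = (d - c) * ((2 * ((b - a) * m c c) + (b - a) * m c d + (b - a) * m d c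
        + 2 * ((b - a) * m d d)) / 6)"
    unfolding inner by (rule integral_unique)
  also have "\<dots> = (b - a) * (d - c) * corner_product_mean a b c d f g"
    unfolding corner_product_mean_def Let_def m_def[symmetric] by (simp add: algebra_simps)
  finally show ?thesis
    using integrable_integral[OF integrable_continuous[OF cont]]
    unfolding integral_prod_continuous[OF cont] by simp
qed

text \<open>
  The reflections are involutions that map boxes to boxes of the same volume.
\<close>

lemma has_integral_reflect_rectangle:
  fixes h :: "real \<Rightarrow> real \<Rightarrow> real"
  assumes "((\<lambda>(x, y). h x y) has_integral I) (cbox (a, c) (b, d))"
  shows "((\<lambda>(x, y). h (a + b - x) y) has_integral I) (cbox (a, c) (b, d))"
    and "((\<lambda>(x, y). h x (c + d - y)) has_integral I) (cbox (a, c) (b, d))"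
proof -
  have seg: "(\<lambda>x. k - x) ` {u..v} = {k - v..k - u}" for k u v :: real
    by (simp add: image_diff_atLeastAtMost)
  define \<sigma> where "\<sigma> z = (a + b - fst z, snd z)" for z :: "real \<times> real"
  define \<tau> where "\<tau> z = (fst z, c + d - snd z)" for z :: "real \<times> real"
  have \<sigma>: "\<sigma> ` cbox u v = cbox (a + b - fst v, snd u) (a + b - fst u, snd v)" for u v
  proof -
    have "\<sigma> = map_prod (\<lambda>x. a + b - x) (\<lambda>y. y)" by (auto simp: \<sigma>_def)
    then show ?thesis
      by (cases u; cases v) (simp add: cbox_Pair_eq map_prod_image seg)
  qed
  have \<tau>: "\<tau> ` cbox u v = cbox (fst u, c + d - snd v) (fst v, c + d - snd u)" for u v
  proof -
    have "\<tau> = map_prod (\<lambda>x. x) (\<lambda>y. c + d - y)" by (auto simp: \<tau>_def)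
    then show ?thesis
      by (cases u; cases v) (simp add: cbox_Pair_eq map_prod_image seg)
  qed
  have "((\<lambda>z. (\<lambda>(x, y). h x y) (\<sigma> z)) has_integral (1 / 1) *\<^sub>R I) (\<sigma> ` cbox (a, c) (b, d))"
    using assms
  proof (rule has_integral_twiddle[rotated -1])
    show "\<sigma> (\<sigma> z) = z" for z by (simp add: \<sigma>_def)
    show "\<sigma> (\<sigma> z) = z" for z by (simp add: \<sigma>_def)
    show "continuous (at z) \<sigma>" for z unfolding \<sigma>_def by (intro continuous_intros)
    show "measure lborel (\<sigma> ` cbox u v) = 1 * measure lborel (cbox u v)" for u v
      unfolding \<sigma> by (cases u; cases v) (simp add: content_Pair content_real_if)
  qed (use \<sigma> in auto)
  then show "((\<lambda>(x, y). h (a + b - x) y) has_integral I) (cbox (a, c) (b, d))"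
    unfolding \<sigma> by (simp add: \<sigma>_def case_prod_unfold)
  have "((\<lambda>z. (\<lambda>(x, y). h x y) (\<tau> z)) has_integral (1 / 1) *\<^sub>R I) (\<tau> ` cbox (a, c) (b, d))"
    using assms
  proof (rule has_integral_twiddle[rotated -1])
    show "\<tau> (\<tau> z) = z" for z by (simp add: \<tau>_def)
    show "\<tau> (\<tau> z) = z" for z by (simp add: \<tau>_def)
    show "continuous (at z) \<tau>" for z unfolding \<tau>_def by (intro continuous_intros)
    show "measure lborel (\<tau> ` cbox u v) = 1 * measure lborel (cbox u v)" for u v
      unfolding \<tau> by (cases u; cases v) (simp add: content_Pair content_real_if)
  qed (use \<tau> in auto)
  then show "((\<lambda>(x, y). h x (c + d - y)) has_integral I) (cbox (a, c) (b, d))"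
    unfolding \<tau> by (simp add: \<tau>_def case_prod_unfold)
qed

lemma has_integral_sum_reflections:
  assumes "((\<lambda>(x, y). h x y) has_integral I) (cbox (a, c) (b, d))"
  shows "((\<lambda>(x, y). sum_reflections a b c d h x y) has_integral 4 * I) (cbox (a, c) (b, d))"
proof -
  note r = has_integral_reflect_rectangle
  have "((\<lambda>z. (\<lambda>(x, y). h x y) z + (\<lambda>(x, y). h (a + b - x) y) z + (\<lambda>(x, y). h x (c + d - y)) z
      + (\<lambda>(x, y). h (a + b - x) (c + d - y)) z) has_integral I + I + I + I) (cbox (a, c) (b, d))"
    by (intro has_integral_add assms r(1)[OF assms] r(2)[OF assms] r(2)[OF r(1)[OF assms]])
  then show ?thesis by (simp add: sum_reflections_def case_prod_unfold)
qed

section \<open>Co-ordinated convex real functions\<close>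

text \<open>
  The endpointwise form of \<^const>\<open>ivl_coord_convex_on\<close>; concavity is expressed as convexity
  of the negated function, so that boundedness and
  continuity have to be proved only once.
\<close>

definition coord_convex_on ::
  "real \<Rightarrow> real \<Rightarrow> real \<Rightarrow> real \<Rightarrow> (real \<Rightarrow> real \<Rightarrow> real) \<Rightarrow> bool" where
  "coord_convex_on a b c d f \<longleftrightarrow>
    (\<forall>x\<in>{a..b}. \<forall>y\<in>{a..b}. \<forall>u\<in>{c..d}. \<forall>w\<in>{c..d}. \<forall>s\<in>{0..1}. \<forall>t\<in>{0..1}.
      f (t * x + (1 - t) * y) (s * u + (1 - s) * w) \<le>
      t * s * f x u + t * (1 - s) * f x w + s * (1 - t) * f y u + (1 - s) * (1 - t) * f y w)"

lemma coord_convex_onD: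
  assumes "coord_convex_on a b c d f"
    and "x \<in> {a..b}" "y \<in> {a..b}" "u \<in> {c..d}" "w \<in> {c..d}" "0 \<le> s" "s \<le> 1" "0 \<le> t" "t \<le> 1"
  shows "f (t * x + (1 - t) * y) (s * u + (1 - s) * w) \<le>
    t * s * f x u + t * (1 - s) * f x w + s * (1 - t) * f y u + (1 - s) * (1 - t) * f y w"
  using assms unfolding coord_convex_on_def by auto

lemma coord_convex_on_imp_convex_on_fst:
  assumes f: "coord_convex_on a b c d f" and "y \<in> {c..d}"
  shows "convex_on {a..b} (\<lambda>x. f x y)"
proof (rule convex_onI)
  fix t x x' :: real assume "0 < t" "t < 1" "x \<in> {a..b}" "x' \<in> {a..b}"
  with coord_convex_onD[OF f, of x' x y y 1 t] assms(2)
  show "f ((1 - t) *\<^sub>R x + t *\<^sub>R x') y \<le> (1 - t) * f x y + t * f x' y"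
    by (simp add: add.commute)
qed simp

lemma coord_convex_on_imp_convex_on_snd:
  assumes f: "coord_convex_on a b c d f" and "x \<in> {a..b}"
  shows "convex_on {c..d} (f x)"
proof (rule convex_onI)
  fix s y y' :: real assume "0 < s" "s < 1" "y \<in> {c..d}" "y' \<in> {c..d}"
  with coord_convex_onD[OF f, of x x y' y s 1] assms(2)
  show "f x ((1 - s) *\<^sub>R y + s *\<^sub>R y') \<le> (1 - s) * f x y + s * f x y'"
    by (simp add: add.commute)
qed simp

lemma linterp_weightE:
  fixes x :: real
  assumes "a < b" "x \<in> {a..b}"
  obtains t where "0 \<le> t" "t \<le> 1" "x = t * a + (1 - t) * b" 
    "\<And>p q. linterp a b p q x = t * p + (1 - t) * q"
proof
  let ?t = "(b - x) / (b - a)"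
  have t: "1 - ?t = (x - a) / (b - a)" using assms by (simp add: field_simps)
  show "0 \<le> ?t" "?t \<le> 1" using assms by auto
  show "linterp a b p q x = ?t * p + (1 - ?t) * q" for p q
    unfolding t by (simp add: linterp_def add_divide_distrib)
  have "(b - x) * a + (x - a) * b = (b - a) * x" by (simp add: algebra_simps)
  then show "x = ?t * a + (1 - ?t) * b"
    unfolding t using assms by (simp flip: add_divide_distrib)
qed

lemma coord_convex_on_le_bilinterp:
  assumes f: "coord_convex_on a b c d f" and "a < b" "c < d" "x \<in> {a..b}" "y \<in> {c..d}"
  shows "f x y \<le> bilinterp a b c d f x y"
proof -
  obtain t where t: "0 \<le> t" "t \<le> 1" "x = t * a + (1 - t) * b"
      "\<And>p q. linterp a b p q x = t * p + (1 - t) * q"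
    using linterp_weightE[OF assms(2,4)] by metis
  obtain s where s: "0 \<le> s" "s \<le> 1" "y = s * c + (1 - s) * d"
      "\<And>p q. linterp c d p q y = s * p + (1 - s) * q"
    using linterp_weightE[OF assms(3,5)] by metis
  have "f x y \<le> t * s * f a c + t * (1 - s) * f a d + s * (1 - t) * f b c + (1 - s) * (1 - t) * f b d"
    unfolding t(3) s(3) using assms t s by (intro coord_convex_onD[OF f]) auto
  also have "\<dots> = bilinterp a b c d f x y"
    unfolding bilinterp_def t(4) s(4) by (simp add: algebra_simps)
  finally show ?thesis .
qed

lemma coord_convex_on_midpoint_le:
  assumes f: "coord_convex_on a b c d f" and "x \<in> {a..b}" "y \<in> {c..d}"
  shows "4 * f ((a + b) / 2) ((c + d) / 2) \<le> sum_reflections a b c d f x y"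
proof -
  have mid: "1 / 2 * x + (1 - 1 / 2) * (a + b - x) = (a + b) / 2"
    "1 / 2 * y + (1 - 1 / 2) * (c + d - y) = (c + d) / 2"
    by (simp_all add: field_simps)
  show ?thesis
    using coord_convex_onD[OF f, of x "a + b - x" y "c + d - y" "1/2" "1/2", unfolded mid] assms
    by (simp add: sum_reflections_def)
qed

text \<open>
  The interpolant at the corners bounds the function above.  A very negative value
  is impossible too: together with the upper bound at the three reflected points it would violate
  the inequality at the centre.
\<close>

lemma coord_convex_on_bounded:
  assumes f: "coord_convex_on a b c d f" and "a < b" "c < d"
  obtains B where "\<And>x y. x \<in> {a..b} \<Longrightarrow> y \<in> {c..d} \<Longrightarrow> \<bar>f x y\<bar> \<le> B"
proof -
  define S where "S = \<bar>f a c\<bar> + \<bar>f a d\<bar> + \<bar>f b c\<bar> + \<bar>f b d\<bar>"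
  have upper: "f x y \<le> S" if xy: "x \<in> {a..b}" "y \<in> {c..d}" for x y
  proof -
    let ?g = "\<lambda>x y. \<bar>f x y\<bar>"
    note refl = xy[unfolded atLeastAtMost_iff]
    have "f x y \<le> bilinterp a b c d f x y"
      using assms xy by (rule coord_convex_on_le_bilinterp)
    also have "\<dots> \<le> bilinterp a b c d ?g x y"
      unfolding bilinterp_def linterp_def using assms refl
      by (intro divide_right_mono add_mono mult_left_mono) auto
    \<comment> \<open>The values at the other three points are nonnegative, and all four add up to a constant.\<close>
    also have "\<dots> \<le> sum_reflections a b c d (bilinterp a b c d ?g) x y"
      using bilinterp_nonneg[OF assms(2,3), of "a + b - x" y ?g]
        bilinterp_nonneg[OF assms(2,3), of x "c + d - y" ?g]
        bilinterp_nonneg[OF assms(2,3), of "a + b - x" "c + d - y" ?g] refl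
      by (simp add: sum_reflections_def)
    also have "\<dots> = S" unfolding sum_reflections_bilinterp[OF assms(2,3)] corner_sum_def S_def by simp
    finally show ?thesis .
  qed
  have lower: "4 * f ((a + b) / 2) ((c + d) / 2) - 3 * S \<le> f x y"
    if xy: "x \<in> {a..b}" "y \<in> {c..d}" for x y
    using coord_convex_on_midpoint_le[OF f xy] upper[of "a + b - x" y] upper[of x "c + d - y"]
      upper[of "a + b - x" "c + d - y"] xy
    by (simp add: sum_reflections_def)
  show thesis
  proof (rule that)
    fix x y assume xy: "x \<in> {a..b}" "y \<in> {c..d}"
    have "0 \<le> S" by (simp add: S_def)
    then show "\<bar>f x y\<bar> \<le> 4 * \<bar>f ((a + b) / 2) ((c + d) / 2)\<bar> + 3 * S"
      using upper[OF xy] lower[OF xy] by linarith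
  qed
qed

text \<open>
  The bound comes from comparing slopes along the line through \<open>x\<close> and \<open>z\<close>, extended to the two points at distance \<open>r\<close>
  from \<open>z\<close>.  The constant depends on \<open>B\<close> and \<open>r\<close> only, which makes the estimate uniform over a family
  of convex functions.
\<close>

lemma convex_on_cball_lipschitz_at_center:
  fixes \<phi> :: "'a::real_normed_vector \<Rightarrow> real"
  assumes conv: "convex_on (cball z r) \<phi>"
    and bound: "\<And>x. x \<in> cball z r \<Longrightarrow> \<bar>\<phi> x\<bar> \<le> B"
    and x: "x \<in> cball z r"
  shows "\<bar>\<phi> x - \<phi> z\<bar> \<le> 2 * B / r * norm (x - z)"
proof (cases "x = z")
  case False
  define h where "h = x - z"
  define l where "l = norm h / r"
  have "h \<noteq> 0" "norm h \<le> r" using x False by (auto simp: h_def dist_norm norm_minus_commute)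
  then have "0 < norm h" "0 < r" by (simp, smt (verit) zero_less_norm_iff)
  then have l: "0 < l" "l \<le> 1" using \<open>norm h \<le> r\<close> by (auto simp: l_def)
  define e where "e = (1 / l) *\<^sub>R h"
  have e: "norm e = r" using \<open>0 < norm h\<close> \<open>0 < r\<close> by (simp add: e_def l_def)
  have le: "h = l *\<^sub>R e" using l by (simp add: e_def)
  have mem: "z \<in> cball z r" "z + e \<in> cball z r" "z - e \<in> cball z r"
    using e \<open>0 < r\<close> by (auto simp: dist_norm)
  have "x = (1 - l) *\<^sub>R z + l *\<^sub>R (z + e)" 
    using le by (simp add: h_def algebra_simps)
  then have "\<phi> x \<le> (1 - l) * \<phi> z + l * \<phi> (z + e)"
    using convex_onD[OF conv, of l z "z + e"] l mem by simp
  moreover have "l * \<phi> (z + e) \<le> l * B" "- (l * \<phi> z) \<le> l * B" 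
    using bound[OF mem(2)] bound[OF mem(1)] l mult_left_mono[of "- \<phi> z" B l] 
    by (auto intro: mult_left_mono)
  ultimately have up: "\<phi> x - \<phi> z \<le> 2 * B * l" by (simp add: algebra_simps)
  \<comment> \<open>The weight with which \<open>z\<close> lies between \<open>x\<close> and the antipodal point \<open>z - e\<close>.\<close>
  define m where "m = l / (1 + l)"
  have m: "0 \<le> m" "m \<le> 1" "1 - m = 1 / (1 + l)" "(1 + l) * m = l"
    using l by (auto simp: m_def field_simps)
  have "(1 - m) *\<^sub>R x + m *\<^sub>R (z - e) = z"
  proof -
    have "(1 - m) *\<^sub>R x + m *\<^sub>R (z - e) = z + ((1 - m) * l - m) *\<^sub>R e"
      using le by (simp add: h_def algebra_simps)
    also have "(1 - m) * l - m = 0" using l by (simp add: m(3)) (simp add: m_def)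
    finally show ?thesis by simp
  qed
  then have "\<phi> z \<le> (1 - m) * \<phi> x + m * \<phi> (z - e)"
    using convex_onD[OF conv, of m x "z - e"] m mem x by simp
  then have "(1 + l) * \<phi> z \<le> (1 + l) * ((1 - m) * \<phi> x + m * \<phi> (z - e))"
    using l by (intro mult_left_mono) auto
  also have "\<dots> = ((1 + l) * (1 - m)) * \<phi> x + ((1 + l) * m) * \<phi> (z - e)"
    by (simp add: algebra_simps)
  also have "\<dots> = \<phi> x + l * \<phi> (z - e)"
    using l m(3,4) by simp
  finally have "(1 + l) * \<phi> z \<le> \<phi> x + l * \<phi> (z - e)" .
  moreover have "l * \<phi> (z - e) \<le> l * B"
    using bound[OF mem(3)] l by (intro mult_left_mono) auto
  ultimately have down: "\<phi> z - \<phi> x \<le> 2 * B * l" 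
    using \<open>- (l * \<phi> z) \<le> l * B\<close> by (simp add: algebra_simps)
  have "2 * B * l = 2 * B / r * norm (x - z)" by (simp add: l_def h_def)
  then show ?thesis using up down by linarith
qed simp

text \<open>
  Continuity in each variable separately would not suffice.  The slices of \<open>f\<close> are convex with a
  common bound, so they satisfy the Lipschitz estimate with one constant; moving first in one
  variable and then in the other yields joint continuity.
\<close>

lemma coord_convex_on_continuous:
  assumes f: "coord_convex_on a b c d f"
  shows "continuous_on (box (a, c) (b, d)) (\<lambda>z. f (fst z) (snd z))"
proof (cases "a < b \<and> c < d")
  case True
  then obtain B where B: "\<And>x y. x \<in> {a..b} \<Longrightarrow> y \<in> {c..d} \<Longrightarrow> \<bar>f x y\<bar> \<le> B"
    using coord_convex_on_bounded[OF f] by metis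
  have "isCont (\<lambda>z. f (fst z) (snd z)) z" if z: "z \<in> box (a, c) (b, d)" for z
  proof -
    obtain x0 y0 where z0: "z = (x0, y0)" by (cases z)
    with z have x0: "a < x0" "x0 < b" and y0: "c < y0" "y0 < d"
      by (auto simp: box_prod)
    define r where "r = Min {x0 - a, b - x0, y0 - c, d - y0}"
    have "r > 0" using x0 y0 by (auto simp: r_def)
    have "r \<le> x0 - a" "r \<le> b - x0" "r \<le> y0 - c" "r \<le> d - y0" by (simp_all add: r_def)
    then have sub: "cball x0 r \<subseteq> {a..b}" "cball y0 r \<subseteq> {c..d}"
      by (simp_all add: cball_eq_atLeastAtMost)
    have mem: "x0 \<in> {a..b}" "\<And>x. x \<in> cball x0 r \<Longrightarrow> x \<in> {a..b}"
        "\<And>y. y \<in> cball y0 r \<Longrightarrow> y \<in> {c..d}"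
      using sub x0 by (simp, blast+)
    have est: "\<bar>f x y - f x0 y0\<bar> \<le> 2 * B / r * (norm (x - x0) + norm (y - y0))"
      if "x \<in> cball x0 r" "y \<in> cball y0 r" for x y
    proof -
      have "\<bar>f x y - f x0 y\<bar> \<le> 2 * B / r * norm (x - x0)"
      proof (rule convex_on_cball_lipschitz_at_center[of _ _ "\<lambda>x. f x y"])
        show "convex_on (cball x0 r) (\<lambda>x. f x y)"
          using coord_convex_on_imp_convex_on_fst[OF f] sub that
          by (intro convex_on_subset[OF _ sub(1)]) auto
      qed (use B mem that in blast)+
      moreover have "\<bar>f x0 y - f x0 y0\<bar> \<le> 2 * B / r * norm (y - y0)"
      proof (rule convex_on_cball_lipschitz_at_center)
        show "convex_on (cball y0 r) (f x0)"
          using coord_convex_on_imp_convex_on_snd[OF f] x0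
          by (intro convex_on_subset[OF _ sub(2)]) auto
      qed (use B mem that in blast)+
      ultimately show ?thesis by (simp add: distrib_left)
    qed
    have "((\<lambda>w. f (fst w) (snd w) - f x0 y0) \<longlongrightarrow> 0) (at z)"
    proof (rule Lim_null_comparison)
      have "eventually (\<lambda>w. w \<in> ball z r) (at z)"
        using \<open>r > 0\<close> by (intro eventually_at_in_open') auto
      then show "eventually (\<lambda>w. norm (f (fst w) (snd w) - f x0 y0)
          \<le> 2 * B / r * (norm (fst w - x0) + norm (snd w - y0))) (at z)"
      proof eventually_elim
        case (elim w)
        then have "fst w \<in> cball x0 r" "snd w \<in> cball y0 r"
          using dist_fst_le[of z w] dist_snd_le[of z w] by (simp_all add: z0)
        then show ?case using est by simp
      qed
      show "((\<lambda>w. 2 * B / r * (norm (fst w - x0) + norm (snd w - y0))) \<longlongrightarrow> 0) (at z)"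
        unfolding z0 using \<open>r > 0\<close> by (auto intro!: tendsto_eq_intros)
    qed
    then show ?thesis
      unfolding isCont_def z0 by (simp add: LIM_zero_cancel)
  qed
  then show ?thesis
    using continuous_at_imp_continuous_on by blast
next
  case False
  then have "box (a, c) (b, d) = {}" by (auto simp: box_prod)
  then show ?thesis by simp
qed

lemma coord_convex_product_has_riemann_integral:
  assumes f: "coord_convex_on a b c d f" and g: "coord_convex_on a b c d g"
    and "a < b" "c < d"
  obtains I where "((\<lambda>(x, y). f x y * g x y) has_riemann_integral I) ({a..b} \<times> {c..d})"
proof -
  obtain B where B: "\<And>x y. x \<in> {a..b} \<Longrightarrow> y \<in> {c..d} \<Longrightarrow> \<bar>f x y\<bar> \<le> B"
    using coord_convex_on_bounded[OF f assms(3,4)] by metis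
  obtain B' where B': "\<And>x y. x \<in> {a..b} \<Longrightarrow> y \<in> {c..d} \<Longrightarrow> \<bar>g x y\<bar> \<le> B'"
    using coord_convex_on_bounded[OF g assms(3,4)] by metis
  have "continuous_on (box (a, c) (b, d)) (\<lambda>(x, y). f x y * g x y)"
    unfolding case_prod_unfold
    by (intro continuous_on_mult coord_convex_on_continuous f g)
  moreover have "\<bar>(\<lambda>(x, y). f x y * g x y) z\<bar> \<le> B * B'" if "z \<in> cbox (a, c) (b, d)" for z
  proof -
    have z: "fst z \<in> {a..b}" "snd z \<in> {c..d}" using that by (auto simp: cbox_Pair_eq)
    have "\<bar>f (fst z) (snd z)\<bar> * \<bar>g (fst z) (snd z)\<bar> \<le> B * B'"
      using B[OF z] B'[OF z] by (intro mult_mono) auto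
    then show ?thesis by (simp add: case_prod_unfold abs_mult)
  qed
  ultimately have "((\<lambda>(x, y). f x y * g x y) has_riemann_integral
      integral (cbox (a, c) (b, d)) (\<lambda>(x, y). f x y * g x y)) (cbox (a, c) (b, d))"
    by (intro has_riemann_integral_if_bounded_continuous_on_box)
  then show thesis
    by (intro that) (simp add: cbox_Pair_eq)
qed

section \<open>The midpoint inequality for products of real functions\<close>

text \<open>
  Off the diagonal, the product of two sums consists of products of nonnegative numbers and is
  therefore monotone.  The diagonal has to be left alone: there the integral of \<open>f g\<close> itself
  must survive in the final estimate.
\<close>

lemma sum_product_minus_diagonal_mono:
  fixes f1 f2 f3 f4 g1 g2 g3 g4 F1 F2 F3 F4 G1 G2 G3 G4 :: real
  assumes "0 \<le> f1" "0 \<le> f2" "0 \<le> f3" "0 \<le> f4" "0 \<le> g1" "0 \<le> g2" "0 \<le> g3" "0 \<le> g4"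
    and "f1 \<le> F1" "f2 \<le> F2" "f3 \<le> F3" "f4 \<le> F4" "g1 \<le> G1" "g2 \<le> G2" "g3 \<le> G3" "g4 \<le> G4"
  shows "(f1 + f2 + f3 + f4) * (g1 + g2 + g3 + g4) - (f1 * g1 + f2 * g2 + f3 * g3 + f4 * g4)
    \<le> (F1 + F2 + F3 + F4) * (G1 + G2 + G3 + G4) - (F1 * G1 + F2 * G2 + F3 * G3 + F4 * G4)"
proof -
  have "f1 * (g2 + g3 + g4) \<le> F1 * (G2 + G3 + G4)" "f2 * (g1 + g3 + g4) \<le> F2 * (G1 + G3 + G4)"
    "f3 * (g1 + g2 + g4) \<le> F3 * (G1 + G2 + G4)" "f4 * (g1 + g2 + g3) \<le> F4 * (G1 + G2 + G3)"
    using assms by (intro mult_mono; linarith)+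
  then show ?thesis by (simp add: algebra_simps)
qed

text \<open>
  The integrand is the function that is compared with the constant \<open>16 f(m) g(m)\<close>, from above
  in the convex case and from below in the concave one.
\<close>

lemma has_integral_symmetrized_comparison:
  assumes "a < b" "c < d"
    and "((\<lambda>(x, y). f x y * g x y) has_integral I) (cbox (a, c) (b, d))"
  shows "((\<lambda>(x, y). corner_sum a b c d f * corner_sum a b c d g
      + sum_reflections a b c d (\<lambda>x y. f x y * g x y
          - bilinterp a b c d f x y * bilinterp a b c d g x y) x y) has_integral
    (b - a) * (d - c) * (corner_sum a b c d f * corner_sum a b c d g
      - 4 * corner_product_mean a b c d f g) + 4 * I) (cbox (a, c) (b, d))"
proof -
  let ?k = "\<lambda>x y. f x y * g x y - bilinterp a b c d f x y * bilinterp a b c d g x y"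
  have "((\<lambda>(x, y). ?k x y) has_integral I - (b - a) * (d - c) * corner_product_mean a b c d f g)
      (cbox (a, c) (b, d))"
    using has_integral_diff[OF assms(3) has_integral_bilinterp_mult_bilinterp[OF assms(1,2), of f g]]
    by (simp add: case_prod_unfold)
  from has_integral_add[OF has_integral_const[of "corner_sum a b c d f * corner_sum a b c d g"]
      has_integral_sum_reflections[OF this]]
  show ?thesis using assms(1,2) by (simp add: case_prod_unfold content_Pair algebra_simps)
qed

lemma coord_convex_product_midpoint_le:
  assumes f: "coord_convex_on a b c d f" and g: "coord_convex_on a b c d g"
    and ab: "a < b" and cd: "c < d"
    and f0: "\<And>x y. x \<in> {a..b} \<Longrightarrow> y \<in> {c..d} \<Longrightarrow> 0 \<le> f x y"
    and g0: "\<And>x y. x \<in> {a..b} \<Longrightarrow> y \<in> {c..d} \<Longrightarrow> 0 \<le> g x y"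
    and I: "((\<lambda>(x, y). f x y * g x y) has_integral I) (cbox (a, c) (b, d))"
  shows "4 * (f ((a + b) / 2) ((c + d) / 2) * g ((a + b) / 2) ((c + d) / 2))
    \<le> I / ((b - a) * (d - c))
      + (corner_sum a b c d f * corner_sum a b c d g / 4 - corner_product_mean a b c d f g)"
proof -
  let ?m = "f ((a + b) / 2) ((c + d) / 2) * g ((a + b) / 2) ((c + d) / 2)"
  let ?E = "\<lambda>x y. corner_sum a b c d f * corner_sum a b c d g
      + sum_reflections a b c d (\<lambda>x y. f x y * g x y
          - bilinterp a b c d f x y * bilinterp a b c d g x y) x y"
  let ?R = "(b - a) * (d - c)"
  have const: "((\<lambda>_. 16 * ?m) has_integral ?R * (16 * ?m)) (cbox (a, c) (b, d))"
    using has_integral_const[of "16 * ?m" "(a, c)" "(b, d)"] ab cd by (simp add: content_Pair)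
  have le_E: "16 * ?m \<le> ?E x y" if xy: "x \<in> {a..b}" "y \<in> {c..d}" for x y
  proof -
    have xy': "a + b - x \<in> {a..b}" "c + d - y \<in> {c..d}" using xy by auto
    note mem = xy xy'
    have "16 * ?m = (4 * f ((a + b) / 2) ((c + d) / 2)) * (4 * g ((a + b) / 2) ((c + d) / 2))"
      by simp
    also have "\<dots> \<le> sum_reflections a b c d f x y * sum_reflections a b c d g x y"
    proof (intro mult_mono coord_convex_on_midpoint_le f g xy)
      show "0 \<le> sum_reflections a b c d f x y"
        unfolding sum_reflections_def using mem by (intro add_nonneg_nonneg f0)
      show "0 \<le> 4 * g ((a + b) / 2) ((c + d) / 2)" using g0 ab cd by simp
    qed
    also have "\<dots> \<le> sum_reflections a b c d (bilinterp a b c d f) x y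
          * sum_reflections a b c d (bilinterp a b c d g) x y
        + sum_reflections a b c d (\<lambda>x y. f x y * g x y
          - bilinterp a b c d f x y * bilinterp a b c d g x y) x y"
    proof -
      note le = coord_convex_on_le_bilinterp[OF f ab cd] coord_convex_on_le_bilinterp[OF g ab cd]
      show ?thesis
        unfolding sum_reflections_def
        using sum_product_minus_diagonal_mono[OF f0[OF mem(1,2)] f0[OF mem(3,2)] f0[OF mem(1,4)]
            f0[OF mem(3,4)] g0[OF mem(1,2)] g0[OF mem(3,2)] g0[OF mem(1,4)] g0[OF mem(3,4)]
            le(1)[OF mem(1,2)] le(1)[OF mem(3,2)] le(1)[OF mem(1,4)] le(1)[OF mem(3,4)]
            le(2)[OF mem(1,2)] le(2)[OF mem(3,2)] le(2)[OF mem(1,4)] le(2)[OF mem(3,4)]]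
        by linarith
    qed
    also have "\<dots> = ?E x y" by (simp add: sum_reflections_bilinterp ab cd)
    finally show ?thesis .
  qed
  have "?R * (16 * ?m) \<le> ?R * (corner_sum a b c d f * corner_sum a b c d g
      - 4 * corner_product_mean a b c d f g) + 4 * I"
    using le_E
    by (intro has_integral_le[OF const has_integral_symmetrized_comparison[OF ab cd I]])
      (auto simp: cbox_Pair_eq)
  moreover have "0 < ?R" using ab cd by simp
  ultimately show ?thesis by (simp add: field_simps)
qed

text \<open>
  The roles of a function and its interpolant are exchanged, as the interpolant is now the smaller
  of the two; it is nonnegative because the corner values are.  A reduction to the convex case by
  negation is impossible, since the multiplications need nonnegative factors.
\<close>

lemma coord_concave_product_midpoint_ge:
  assumes f: "coord_convex_on a b c d (\<lambda>x y. - f x y)" and g: "coord_convex_on a b c d (\<lambda>x y. - g x y)"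
    and ab: "a < b" and cd: "c < d"
    and f0: "\<And>x y. x \<in> {a..b} \<Longrightarrow> y \<in> {c..d} \<Longrightarrow> 0 \<le> f x y"
    and g0: "\<And>x y. x \<in> {a..b} \<Longrightarrow> y \<in> {c..d} \<Longrightarrow> 0 \<le> g x y"
    and I: "((\<lambda>(x, y). f x y * g x y) has_integral I) (cbox (a, c) (b, d))"
  shows "I / ((b - a) * (d - c))
      + (corner_sum a b c d f * corner_sum a b c d g / 4 - corner_product_mean a b c d f g)
    \<le> 4 * (f ((a + b) / 2) ((c + d) / 2) * g ((a + b) / 2) ((c + d) / 2))"
proof -
  let ?m = "f ((a + b) / 2) ((c + d) / 2) * g ((a + b) / 2) ((c + d) / 2)"
  let ?E = "\<lambda>x y. corner_sum a b c d f * corner_sum a b c d g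
      + sum_reflections a b c d (\<lambda>x y. f x y * g x y
          - bilinterp a b c d f x y * bilinterp a b c d g x y) x y"
  let ?R = "(b - a) * (d - c)"
  have const: "((\<lambda>_. 16 * ?m) has_integral ?R * (16 * ?m)) (cbox (a, c) (b, d))"
    using has_integral_const[of "16 * ?m" "(a, c)" "(b, d)"] ab cd by (simp add: content_Pair)
  have E_le: "?E x y \<le> 16 * ?m" if xy: "x \<in> {a..b}" "y \<in> {c..d}" for x y
  proof -
    have xy': "a + b - x \<in> {a..b}" "c + d - y \<in> {c..d}" using xy by auto
    note mem = xy xy'
    have "?E x y = sum_reflections a b c d (bilinterp a b c d f) x y
          * sum_reflections a b c d (bilinterp a b c d g) x y
        + sum_reflections a b c d (\<lambda>x y. f x y * g x y
          - bilinterp a b c d f x y * bilinterp a b c d g x y) x y"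
      by (simp add: sum_reflections_bilinterp ab cd)
    also have "\<dots> \<le> sum_reflections a b c d f x y * sum_reflections a b c d g x y"
    proof -
      note f0' = bilinterp_nonneg[where f = f, OF ab cd _ _ f0]
      note g0' = bilinterp_nonneg[where f = g, OF ab cd _ _ g0]
      note le = coord_convex_on_le_bilinterp[OF f ab cd, unfolded bilinterp_minus neg_le_iff_le]
        coord_convex_on_le_bilinterp[OF g ab cd, unfolded bilinterp_minus neg_le_iff_le]
      show ?thesis
        unfolding sum_reflections_def
        using sum_product_minus_diagonal_mono[OF f0'[OF mem(1,2)] f0'[OF mem(3,2)] f0'[OF mem(1,4)]
            f0'[OF mem(3,4)] g0'[OF mem(1,2)] g0'[OF mem(3,2)] g0'[OF mem(1,4)] g0'[OF mem(3,4)]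
            le(1)[OF mem(1,2)] le(1)[OF mem(3,2)] le(1)[OF mem(1,4)] le(1)[OF mem(3,4)]
            le(2)[OF mem(1,2)] le(2)[OF mem(3,2)] le(2)[OF mem(1,4)] le(2)[OF mem(3,4)]]
        by linarith
    qed
    also have "\<dots> \<le> (4 * f ((a + b) / 2) ((c + d) / 2)) * (4 * g ((a + b) / 2) ((c + d) / 2))"
    proof (rule mult_mono)
      show "sum_reflections a b c d f x y \<le> 4 * f ((a + b) / 2) ((c + d) / 2)"
        using coord_convex_on_midpoint_le[OF f xy] by (simp add: sum_reflections_def)
      show "sum_reflections a b c d g x y \<le> 4 * g ((a + b) / 2) ((c + d) / 2)"
        using coord_convex_on_midpoint_le[OF g xy] by (simp add: sum_reflections_def)
      show "0 \<le> sum_reflections a b c d g x y"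
        unfolding sum_reflections_def using mem by (intro add_nonneg_nonneg g0)
      show "0 \<le> 4 * f ((a + b) / 2) ((c + d) / 2)" using f0 ab cd by simp
    qed
    also have "\<dots> = 16 * ?m" by simp
    finally show ?thesis .
  qed
  have "?R * (corner_sum a b c d f * corner_sum a b c d g
      - 4 * corner_product_mean a b c d f g) + 4 * I \<le> ?R * (16 * ?m)"
    using E_le
    by (intro has_integral_le[OF has_integral_symmetrized_comparison[OF ab cd I] const])
      (auto simp: cbox_Pair_eq)
  moreover have "0 < ?R" using ab cd by simp
  ultimately show ?thesis by (simp add: field_simps)
qed

section \<open>Interval endpoints\<close>

lemma set_of_subset_iff:
  fixes X Y :: "'a::linorder interval"
  shows "set_of X \<subseteq> set_of Y \<longleftrightarrow> lower Y \<le> lower X \<and> upper X \<le> upper Y"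
  by (simp add: set_of_eq)

lemma lower_Ivl: "lower (Ivl a b) = min a b"
  by (simp add: lower.rep_eq Ivl.rep_eq)

lemma upper_Ivl: "upper (Ivl a b) = b"
  by (simp add: upper.rep_eq Ivl.rep_eq)

lemma ivl_coord_convex_on_imp_coord_convex_on:
  assumes "ivl_coord_convex_on a b c d F"
  shows "coord_convex_on a b c d (\<lambda>x y. lower (F x y))"
    and "coord_convex_on a b c d (\<lambda>x y. - upper (F x y))"
proof -
  have *: "lower (F (t * x + (1 - t) * y) (s * u + (1 - s) * w)) \<le>
      t * s * lower (F x u) + t * (1 - s) * lower (F x w)
        + s * (1 - t) * lower (F y u) + (1 - s) * (1 - t) * lower (F y w) \<and>
      t * s * upper (F x u) + t * (1 - s) * upper (F x w)
        + s * (1 - t) * upper (F y u) + (1 - s) * (1 - t) * upper (F y w)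
      \<le> upper (F (t * x + (1 - t) * y) (s * u + (1 - s) * w))"
    if "x\<in>{a..b}" "y\<in>{a..b}" "u\<in>{c..d}" "w\<in>{c..d}" "s\<in>{0..1}" "t\<in>{0..1}" for x y u w s t
  proof -
    have "0 \<le> t * s" "0 \<le> t * (1 - s)" "0 \<le> s * (1 - t)" "0 \<le> (1 - s) * (1 - t)"
      using that by auto
    note bounds = this[THEN scale_interval_bounds(1)] this[THEN scale_interval_bounds(2)]
    have "set_of ((t * s) *\<^sub>I F x u + (t * (1 - s)) *\<^sub>I F x w
            + (s * (1 - t)) *\<^sub>I F y u + ((1 - s) * (1 - t)) *\<^sub>I F y w)
        \<subseteq> set_of (F (t * x + (1 - t) * y) (s * u + (1 - s) * w))"
      using assms that unfolding ivl_coord_convex_on_def by blast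
    then show ?thesis
      unfolding set_of_subset_iff lower_plus upper_plus bounds by simp
  qed
  show "coord_convex_on a b c d (\<lambda>x y. lower (F x y))"
    unfolding coord_convex_on_def using * by blast
  show "coord_convex_on a b c d (\<lambda>x y. - upper (F x y))"
    unfolding coord_convex_on_def
  proof (intro ballI)
    fix x y u w s t :: real
    assume "x\<in>{a..b}" "y\<in>{a..b}" "u\<in>{c..d}" "w\<in>{c..d}" "s\<in>{0..1}" "t\<in>{0..1}"
    from *[OF this]
    show "- upper (F (t * x + (1 - t) * y) (s * u + (1 - s) * w)) \<le>
        t * s * - upper (F x u) + t * (1 - s) * - upper (F x w)
          + s * (1 - t) * - upper (F y u) + (1 - s) * (1 - t) * - upper (F y w)"
      by linarith
  qed
qed

text \<open>
  The combination of vertex products in the theorem, with coefficients \<open>5/36\<close>, \<open>7/36\<close> and \<open>2/9\<close>, is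
  one quarter of all sixteen products minus the mean of the product of the interpolants.
\<close>

lemma vertex_sum_bounds:
  assumes "pos_interval (F a c)" "pos_interval (F a d)" "pos_interval (F b c)" "pos_interval (F b d)"
    and "pos_interval (G a c)" "pos_interval (G a d)" "pos_interval (G b c)" "pos_interval (G b d)"
  defines "T \<equiv> (5 / 36) *\<^sub>I vertex_sum_P F G a b c d + (7 / 36) *\<^sub>I vertex_sum_M F G a b c d
         + (2 / 9) *\<^sub>I vertex_sum_N F G a b c d"
  shows "lower T = corner_sum a b c d (\<lambda>x y. lower (F x y)) * corner_sum a b c d (\<lambda>x y. lower (G x y)) / 4
      - corner_product_mean a b c d (\<lambda>x y. lower (F x y)) (\<lambda>x y. lower (G x y))"
    and "upper T = corner_sum a b c d (\<lambda>x y. upper (F x y)) * corner_sum a b c d (\<lambda>x y. upper (G x y)) / 4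
      - corner_product_mean a b c d (\<lambda>x y. upper (F x y)) (\<lambda>x y. upper (G x y))"
proof -
  have nonneg: "0 \<le> (5 / 36 :: real)" "0 \<le> (7 / 36 :: real)" "0 \<le> (2 / 9 :: real)" by simp_all
  note unfolds = T_def lower_plus upper_plus nonneg[THEN scale_interval_bounds(1)]
    nonneg[THEN scale_interval_bounds(2)] vertex_sum_P_def vertex_sum_M_def vertex_sum_N_def
    corner_sum_def corner_product_mean_def Let_def
  note times = pos_interval_times_bounds[OF assms(1) assms(5)] pos_interval_times_bounds[OF assms(1) assms(6)]
    pos_interval_times_bounds[OF assms(1) assms(7)] pos_interval_times_bounds[OF assms(1) assms(8)]
    pos_interval_times_bounds[OF assms(2) assms(5)] pos_interval_times_bounds[OF assms(2) assms(6)]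
    pos_interval_times_bounds[OF assms(2) assms(7)] pos_interval_times_bounds[OF assms(2) assms(8)]
    pos_interval_times_bounds[OF assms(3) assms(5)] pos_interval_times_bounds[OF assms(3) assms(6)]
    pos_interval_times_bounds[OF assms(3) assms(7)] pos_interval_times_bounds[OF assms(3) assms(8)]
    pos_interval_times_bounds[OF assms(4) assms(5)] pos_interval_times_bounds[OF assms(4) assms(6)]
    pos_interval_times_bounds[OF assms(4) assms(7)] pos_interval_times_bounds[OF assms(4) assms(8)]
  show "lower T = corner_sum a b c d (\<lambda>x y. lower (F x y)) * corner_sum a b c d (\<lambda>x y. lower (G x y)) / 4
      - corner_product_mean a b c d (\<lambda>x y. lower (F x y)) (\<lambda>x y. lower (G x y))"
    unfolding unfolds times by (simp add: field_simps)
  show "upper T = corner_sum a b c d (\<lambda>x y. upper (F x y)) * corner_sum a b c d (\<lambda>x y. upper (G x y)) / 4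
      - corner_product_mean a b c d (\<lambda>x y. upper (F x y)) (\<lambda>x y. upper (G x y))"
    unfolding unfolds times by (simp add: field_simps)
qed

theorem theorem9:
  fixes a b c d :: real
    and F G :: "real \<Rightarrow> real \<Rightarrow> real interval"
  assumes "a < b" and "c < d"
    and "\<And>x y. x \<in> {a..b} \<Longrightarrow> y \<in> {c..d} \<Longrightarrow> pos_interval (F x y)"
    and "\<And>x y. x \<in> {a..b} \<Longrightarrow> y \<in> {c..d} \<Longrightarrow> pos_interval (G x y)"
    and "ivl_coord_convex_on a b c d F"
    and "ivl_coord_convex_on a b c d G"
  shows "(\<lambda>(x, y). F x y * G x y) ivl_riemann_integrable_on ({a..b} \<times> {c..d})
    \<and> set_of (4 *\<^sub>I (F ((a + b) / 2) ((c + d) / 2) * G ((a + b) / 2) ((c + d) / 2)))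
      \<supseteq> set_of
        ((1 / ((b - a) * (d - c))) *\<^sub>I
            ivl_riemann_integral ({a..b} \<times> {c..d}) (\<lambda>(x, y). F x y * G x y)
         + (5 / 36) *\<^sub>I vertex_sum_P F G a b c d
         + (7 / 36) *\<^sub>I vertex_sum_M F G a b c d
         + (2 / 9) *\<^sub>I vertex_sum_N F G a b c d)"
proof -
  note ab = \<open>a < b\<close> and cd = \<open>c < d\<close>
  note posF = assms(3) and posG = assms(4)
  note convF = ivl_coord_convex_on_imp_coord_convex_on[OF assms(5)]
  note convG = ivl_coord_convex_on_imp_coord_convex_on[OF assms(6)]
  let ?S = "{a..b} \<times> {c..d}"
  let ?H = "\<lambda>(x, y). F x y * G x y"
  define lF uF lG uG where "lF x y = lower (F x y)" and "uF x y = upper (F x y)"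
    and "lG x y = lower (G x y)" and "uG x y = upper (G x y)" for x y
  note ends = lF_def uF_def lG_def uG_def
  have nonneg: "0 \<le> lF x y" "0 \<le> lG x y" "0 \<le> uF x y" "0 \<le> uG x y"
    if "x \<in> {a..b}" "y \<in> {c..d}" for x y
    using posF[OF that] posG[OF that] lower_le_upper[of "F x y"] lower_le_upper[of "G x y"]
    unfolding pos_interval_def ends by linarith+
  obtain L where L: "((\<lambda>(x, y). lF x y * lG x y) has_riemann_integral L) ?S"
    using coord_convex_product_has_riemann_integral[OF convF(1) convG(1) ab cd]
    unfolding ends by blast
  obtain U where U: "((\<lambda>(x, y). uF x y * uG x y) has_riemann_integral U) ?S"
    using coord_convex_product_has_riemann_integral[OF convF(2) convG(2) ab cd]
    unfolding ends minus_mult_minus by blast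
  have lower_H: "lower (?H z) = (\<lambda>(x, y). lF x y * lG x y) z"
    and upper_H: "upper (?H z) = (\<lambda>(x, y). uF x y * uG x y) z" if "z \<in> ?S" for z
    using that pos_interval_times_bounds[OF posF posG] by (auto simp: ends)
  have LH: "((\<lambda>z. lower (?H z)) has_riemann_integral L) ?S"
    using L has_riemann_integral_cong[of ?S "\<lambda>z. lower (?H z)", OF lower_H] by blast
  have UH: "((\<lambda>z. upper (?H z)) has_riemann_integral U) ?S"
    using U has_riemann_integral_cong[of ?S "\<lambda>z. upper (?H z)", OF upper_H] by blast
  have box: "?S = cbox (a, c) (b, d)" by (simp add: cbox_Pair_eq)
  note hk = has_riemann_integral_imp_has_integral[where u = "(a, c)" and v = "(b, d)", folded box]
  note unique = riemann_integral_unique[where u = "(a, c)" and v = "(b, d)", folded box]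
  have "L \<le> U"
    by (rule has_integral_le[OF hk[OF LH] hk[OF UH]]) (rule lower_le_upper)
  then have integral_H: "lower (ivl_riemann_integral ?S ?H) = L" "upper (ivl_riemann_integral ?S ?H) = U"
    unfolding ivl_riemann_integral_def unique[OF LH] unique[OF UH] using \<open>L \<le> U\<close> by (simp_all add: lower_Ivl upper_Ivl)
  have mem: "(a + b) / 2 \<in> {a..b}" "(c + d) / 2 \<in> {c..d}" and
    corners: "a \<in> {a..b}" "b \<in> {a..b}" "c \<in> {c..d}" "d \<in> {c..d}"
    using ab cd by auto
  let ?R = "(b - a) * (d - c)"
  let ?T = "(5 / 36) *\<^sub>I vertex_sum_P F G a b c d + (7 / 36) *\<^sub>I vertex_sum_M F G a b c d
         + (2 / 9) *\<^sub>I vertex_sum_N F G a b c d"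
  note T = vertex_sum_bounds[of F a c d b G, OF posF[OF corners(1,3)] posF[OF corners(1,4)]
      posF[OF corners(2,3)] posF[OF corners(2,4)] posG[OF corners(1,3)] posG[OF corners(1,4)]
      posG[OF corners(2,3)] posG[OF corners(2,4)], folded ends]
  have "L / ?R + lower ?T \<ge> 4 * (lF ((a + b) / 2) ((c + d) / 2) * lG ((a + b) / 2) ((c + d) / 2))"
    unfolding T using hk[OF L] nonneg
    by (intro coord_convex_product_midpoint_le convF(1)[folded ends] convG(1)[folded ends] ab cd)
      (simp_all add: cbox_Pair_eq)
  moreover have "U / ?R + upper ?T \<le> 4 * (uF ((a + b) / 2) ((c + d) / 2) * uG ((a + b) / 2) ((c + d) / 2))"
    unfolding T using hk[OF U] nonneg
    by (intro coord_concave_product_midpoint_ge convF(2)[folded ends] convG(2)[folded ends] ab cd)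
      (simp_all add: cbox_Pair_eq)
  moreover have "0 \<le> 1 / ?R" "0 \<le> (4 :: real)" using ab cd by simp_all
  note scale = this[THEN scale_interval_bounds(1)] this[THEN scale_interval_bounds(2)]
  ultimately have "set_of ((1 / ?R) *\<^sub>I ivl_riemann_integral ?S ?H + ?T)
      \<subseteq> set_of (4 *\<^sub>I (F ((a + b) / 2) ((c + d) / 2) * G ((a + b) / 2) ((c + d) / 2)))"
    unfolding set_of_subset_iff lower_plus[of "(1 / ?R) *\<^sub>I ivl_riemann_integral ?S ?H"]
      upper_plus[of "(1 / ?R) *\<^sub>I ivl_riemann_integral ?S ?H"] scale integral_H
      pos_interval_times_bounds[OF posF[OF mem] posG[OF mem]] ends by simp
  moreover have "?H ivl_riemann_integrable_on ?S"
    unfolding ivl_riemann_integrable_on_def riemann_integrable_on_def using LH UH by blast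
  ultimately show ?thesis by (simp add: add.assoc)
qed

end
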